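(* Let $Y$ be an LCTV space, $X=\mathbb R^m$, and let $f\colon Y\to\mathbb R$ and $g_i\colon Y\to\mathbb R$, $i=1,\dots,m$, be functions. Define $\phi(x,y):=f(y)$ for $(x,y)\in X\times Y$, $F(x):=\{y\in Y\mid g_i(y)\le x_i\text{ for all }i=1,\dots,m\}$ for $x=(x_1,\dots,x_m)\in X$, and $\mu(x):=\inf\{\phi(x,y)\mid y\in F(x)\}$. Then for every $\lambda=(\lambda_1,\dots,\lambda_m)\in X^*=\mathbb R^m$, $$\mu^*(-\lambda)=\begin{cases}-\widehat{\mathcal L}(\lambda)&\text{if }\lambda\ge0,\\ \infty&\text{otherwise},\end{cases}$$ where $\widehat{\mathcal L}(\lambda):=\inf_{y\in Y}\big\{f(y)+\sum_{i=1}^m\lambda_ig_i(y)\big\}$.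
   Context: LCTV space means real locally convex Hausdorff topological vector space. $\inf\emptyset=\infty$. $\lambda\ge0$ means $\lambda_i\ge0$ for all $i$. $\mu^*(\lambda)=\sup\{\langle\lambda,x\rangle-\mu(x)\mid x\in\mathbb R^m\}$ is the Fenchel conjugate, with $\langle\lambda,x\rangle=\sum_i\lambda_ix_i$; values may be $\pm\infty$. *)

theory Defs
  imports "HOL-Analysis.Analysis"
begin

text \<open>
  Real locally convex Hausdorff topological vector spaces. Continuity of addition and negation
  comes from the class of topological abelian groups, the Hausdorff property from
  the class \<open>t2_space\<close>. The constant \<open>convex\<close> cannot be used inside the class specification
  (its type carries the sort \<open>real_vector\<close>), so its definition is written out there.
\<close>

class lctv_space = real_vector + topological_ab_group_add + t2_space +
  assumes tendsto_scaleR_nhds_prod: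
    "LIM p (nhds c \<times>\<^sub>F nhds x). fst p *\<^sub>R snd p :> nhds (c *\<^sub>R x)"
  and locally_convex_at_zero_unfolded:
    "open U \<Longrightarrow> 0 \<in> U \<Longrightarrow> \<exists>V. open V \<and>
      (\<forall>x\<in>V. \<forall>y\<in>V. \<forall>u\<ge>0. \<forall>v\<ge>0. u + v = 1 \<longrightarrow> u *\<^sub>R x + v *\<^sub>R y \<in> V) \<and>
      0 \<in> V \<and> V \<subseteq> U"

lemma locally_convex_at_zero:
  fixes U :: "'a::lctv_space set"
  assumes "open U" "0 \<in> U"
  shows "\<exists>V. open V \<and> convex V \<and> 0 \<in> V \<and> V \<subseteq> U"
  using locally_convex_at_zero_unfolded[OF assms] unfolding convex_def .

instance real_normed_vector \<subseteq> lctv_space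
proof
  fix c :: real and x :: 'a
  show "LIM p (nhds c \<times>\<^sub>F nhds x). fst p *\<^sub>R snd p :> nhds (c *\<^sub>R x)"
    by (intro tendsto_scaleR filterlim_fst filterlim_snd)
next
  fix U :: "'a set"
  assume "open U" "0 \<in> U"
  then obtain e where "e > 0" "ball 0 e \<subseteq> U"
    by (meson open_contains_ball)
  then have "open (ball 0 e) \<and> convex (ball (0::'a) e) \<and> 0 \<in> ball (0::'a) e \<and> ball 0 e \<subseteq> U"
    by auto
  then show "\<exists>V. open V \<and>
      (\<forall>x\<in>V. \<forall>y\<in>V. \<forall>u\<ge>0. \<forall>v\<ge>0. u + v = 1 \<longrightarrow> u *\<^sub>R x + v *\<^sub>R y \<in> V) \<and>
      0 \<in> V \<and> V \<subseteq> U"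
    unfolding convex_def by blast
qed

text \<open>
  Extended-real infima and suprema are taken in the complete lattice \<^typ>\<open>ereal\<close>; in particular
  the infimum over the empty set is \<open>\<infinity>\<close>.
\<close>

definition marginal_function :: "('x \<times> 'y \<Rightarrow> ereal) \<Rightarrow> ('x \<Rightarrow> 'y set) \<Rightarrow> 'x \<Rightarrow> ereal" where
  "marginal_function \<phi> F x = (INF y\<in>F x. \<phi> (x, y))"

text \<open>
  The dual of \<open>\<real>\<^sup>m\<close> is identified with \<open>\<real>\<^sup>m\<close> through the standard inner product. The minuend is
  finite, so the difference is never of the form \<open>\<infinity> - \<infinity>\<close>.
\<close>

definition fenchel_conjugate :: "(real ^ 'm \<Rightarrow> ereal) \<Rightarrow> real ^ 'm \<Rightarrow> ereal" where
  "fenchel_conjugate \<mu> l = (SUP x. ereal (l \<bullet> x) - \<mu> x)"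

definition constraint_map :: "('m \<Rightarrow> 'y \<Rightarrow> real) \<Rightarrow> real ^ 'm \<Rightarrow> 'y set" where
  "constraint_map g x = {y. \<forall>i. g i y \<le> x $ i}"

definition cost_function :: "('y \<Rightarrow> real) \<Rightarrow> 'x \<times> 'y \<Rightarrow> ereal" where
  "cost_function f = (\<lambda>(x, y). ereal (f y))"

definition lagrange_dual :: "('y \<Rightarrow> real) \<Rightarrow> ('m::finite \<Rightarrow> 'y \<Rightarrow> real) \<Rightarrow> real ^ 'm \<Rightarrow> ereal" where
  "lagrange_dual f g l = (INF y. ereal (f y + (\<Sum>i\<in>UNIV. l $ i * g i y)))"

end

theory Submission
  imports Defs
begin

text \<open>
  Since the marginal function is itself an infimum, its conjugate is a single supremum over the
  graph of the feasibility map (\<open>fenchel_conjugate_marginal\<close>), and one may maximise over \<open>x\<close>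
  first, keeping the decision \<open>y\<close> fixed. The admissible \<open>x\<close> are then those of the orthant
  \<open>x \<ge> g(y)\<close>, and the linear form \<open>-\<langle>l, x\<rangle>\<close> is to be maximised on it. If \<open>l \<ge> 0\<close>, the maximum is
  at the vertex \<open>x = g(y)\<close>, which turns the objective into minus the Lagrangian at \<open>y\<close>
  (\<open>sup_orthant_nonneg\<close>). If some coordinate of \<open>l\<close> is negative, the form is unbounded along the
  corresponding edge of the orthant (\<open>sup_orthant_neg\<close>).
\<close>

text \<open>
  Subtracting an infimum from a finite number gives a supremum of differences, and two suprema
  commute even when the range \<open>F x\<close> of one depends on the variable of the other.
\<close>

lemma fenchel_conjugate_marginal:
  fixes \<phi> :: "(real ^ 'm) \<times> 'y \<Rightarrow> ereal"
  shows "fenchel_conjugate (marginal_function \<phi> F) l =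
    (SUP y. SUP x\<in>{x. y \<in> F x}. ereal (l \<bullet> x) - \<phi> (x, y))"
proof -
  have inner: "ereal c - marginal_function \<phi> F x = (SUP y\<in>F x. ereal c - \<phi> (x, y))" for c x
  proof (cases "F x = {}")
    case True
    \<comment> \<open>The infimum is \<open>\<infinity>\<close> and the supremum \<open>-\<infinity>\<close>; the sides agree as \<open>c\<close> is finite.\<close>
    then show ?thesis
      by (simp add: marginal_function_def top_ereal_def bot_ereal_def)
  next
    case False
    then show ?thesis
      unfolding marginal_function_def minus_ereal_def
      by (simp add: ereal_SUP_uminus_eq SUP_ereal_add_right flip: ereal_INF_uminus_eq)
  qed
  show ?thesis
    unfolding fenchel_conjugate_def inner
    by (intro antisym SUP_least) (auto intro!: SUP_upper2)
qed

lemma sup_orthant_nonneg: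
  fixes l a :: "real ^ 'm"
  assumes "\<forall>i. 0 \<le> l $ i"
  shows "(SUP x\<in>{x. \<forall>i. a $ i \<le> x $ i}. ereal (- l \<bullet> x) - ereal c) = - ereal (c + l \<bullet> a)"
proof (rule antisym)
  have "l \<bullet> a \<le> l \<bullet> x" if "\<forall>i. a $ i \<le> x $ i" for x
    using assms that by (auto simp: inner_vec_def intro!: sum_mono mult_left_mono)
  then show "(SUP x\<in>{x. \<forall>i. a $ i \<le> x $ i}. ereal (- l \<bullet> x) - ereal c) \<le> - ereal (c + l \<bullet> a)"
    by (auto intro!: SUP_least)
  show "- ereal (c + l \<bullet> a) \<le> (SUP x\<in>{x. \<forall>i. a $ i \<le> x $ i}. ereal (- l \<bullet> x) - ereal c)"
    by (rule SUP_upper2[of a]) auto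
qed

lemma sup_orthant_neg:
  fixes l a :: "real ^ 'm"
  assumes "l $ j < 0"
  shows "(SUP x\<in>{x. \<forall>i. a $ i \<le> x $ i}. ereal (- l \<bullet> x) - ereal c) = \<infinity>"
proof (rule SUP_PInfty)
  fix n :: nat
  \<comment> \<open>The value at \<open>a + t e\<^sub>j\<close> is \<open>-\<langle>l, a\<rangle> - c + t \<bar>l\<^sub>j\<bar>\<close>; this \<open>t\<close> makes it at least \<open>n\<close>.\<close>
  define t where "t = (real n + \<bar>l \<bullet> a + c\<bar>) / - l $ j"
  define x where "x = a + t *\<^sub>R axis j 1"
  have "0 \<le> t"
    using assms unfolding t_def by (intro divide_nonneg_pos) auto
  then have "\<forall>i. a $ i \<le> x $ i"
    by (simp add: x_def axis_def)
  moreover have "t * l $ j = - (real n + \<bar>l \<bullet> a + c\<bar>)"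
    using assms by (simp add: t_def field_simps)
  then have "real n \<le> - l \<bullet> x - c"
    by (simp add: x_def inner_add_right inner_axis)
  ultimately show "\<exists>x\<in>{x. \<forall>i. a $ i \<le> x $ i}. ereal (real n) \<le> ereal (- l \<bullet> x) - ereal c"
    by auto
qed

theorem theorem8p2:
  fixes f :: "'y::lctv_space \<Rightarrow> real"
    and g :: "'m::finite \<Rightarrow> 'y \<Rightarrow> real"
    and \<mu> :: "real ^ 'm \<Rightarrow> ereal"
    and l :: "real ^ 'm"
  defines "\<mu> \<equiv> marginal_function (cost_function f) (constraint_map g)"
  shows "fenchel_conjugate \<mu> (- l) =
    (if \<forall>i. 0 \<le> l $ i then - lagrange_dual f g l else \<infinity>)"
proof -
  have conj: "fenchel_conjugate \<mu> (- l) =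
      (SUP y. SUP x\<in>{x. \<forall>i. (\<chi> i. g i y) $ i \<le> x $ i}. ereal (- l \<bullet> x) - ereal (f y))"
    unfolding \<mu>_def fenchel_conjugate_marginal
    by (simp add: cost_function_def constraint_map_def)
  show ?thesis
  proof (cases "\<forall>i. 0 \<le> l $ i")
    case True
    have "fenchel_conjugate \<mu> (- l) = (SUP y. - ereal (f y + l \<bullet> (\<chi> i. g i y)))"
      unfolding conj sup_orthant_nonneg[OF True] ..
    also have "\<dots> = - lagrange_dual f g l"
      unfolding lagrange_dual_def ereal_SUP_uminus_eq by (simp add: inner_vec_def)
    finally show ?thesis
      using True by simp
  next
    case False
    then obtain j where "l $ j < 0"
      by (auto simp: not_le)
    then have "fenchel_conjugate \<mu> (- l) = \<infinity>"
      unfolding conj sup_orthant_neg[OF \<open>l $ j < 0\<close>] by simp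
    then show ?thesis
      using False by auto
  qed
qed

end
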